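(* Let $G$ be a connected graph of order $n$ and diameter $2$ without any universal vertex. Let $\sigma(\mathcal{L}(G))=\{\mu_1,\mu_2,\dots,\mu_{n-1},\mu_n=0\}$ and $\sigma(\mathcal{Q}(G))=\{q_1,q_2,\dots,q_n\}$. (i) Then $\sigma(\mathcal{E}^{\mathcal{L}}(G))=\{2n-2\mu_{n-1},\,2n-2\mu_{n-2},\dots,2n-2\mu_1,\,0\}$ (with multiplicity), and the corresponding eigenvectors are the same: for $1\leq i\leq n-1$ every eigenvector of $\mathcal{L}(G)$ for $\mu_i$ is an eigenvector of $\mathcal{E}^{\mathcal{L}}(G)$ for $2n-2\mu_i$, and the all-ones vector $\mathbf{1}$ (the eigenvector of $\mathcal{L}(G)$ for $\mu_n=0$) is an eigenvector of $\mathcal{E}^{\mathcal{L}}(G)$ for $0$. (ii) Furthermore, if $G$ is $r$-regular, with $q_1=2r$ the eigenvalue of $\mathcal{Q}(G)$ belonging to the eigenvector $\mathbf{1}$, then $\sigma(\mathcal{E}^{\mathcal{Q}}(G))=\{4(n-r-1),\,2n-4-2q_2,\dots,2n-4-2q_n\}$ (with multiplicity), and the corresponding eigenvectors are the same: $\mathbf{1}$ is an eigenvector of $\mathcal{E}^{\mathcal{Q}}(G)$ for $4(n-r-1)$, and for $2\leq i\leq n$ every eigenvector of $\mathcal{Q}(G)$ for $q_i$ is an eigenvector of $\mathcal{E}^{\mathcal{Q}}(G)$ for $2n-4-2q_i$.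
   Context: Graphs are finite, simple and undirected. A universal vertex of a graph of order $n$ is a vertex of degree $n-1$. $\mathcal{L}(G)=\mathrm{Diag}(\mathrm{Deg}(G))-\mathcal{A}(G)$ is the Laplacian and $\mathcal{Q}(G)=\mathrm{Diag}(\mathrm{Deg}(G))+\mathcal{A}(G)$ the signless Laplacian, with $\mathcal{A}(G)$ the adjacency matrix and $\mathrm{Diag}(\mathrm{Deg}(G))$ the diagonal matrix of degrees. $\sigma(A)$ is the spectrum of $A$ (with multiplicity). For a connected graph $G$ with vertices $v_1,\dots,v_n$, $d(v_i,v_j)$ is the length of a shortest path and $e(v_i)=\max_j d(v_i,v_j)$. The eccentricity matrix $\mathcal{E}(G)$ has entries $\mathcal{E}_{ij}(G)=d(v_i,v_j)$ if $d(v_i,v_j)=\min\{e(v_i),e(v_j)\}$ and $\mathcal{E}_{ij}(G)=0$ if $d(v_i,v_j)<\min\{e(v_i),e(v_j)\}$. Put $\mathrm{Tr}_{\mathcal{E}}(v_i)=\sum_j\mathcal{E}_{ij}(G)$ and let $\mathrm{Diag}(\mathrm{Tr}_{\mathcal{E}}(G))$ be the diagonal matrix of these numbers. Then $\mathcal{E}^{\mathcal{L}}(G)=\mathrm{Diag}(\mathrm{Tr}_{\mathcal{E}}(G))-\mathcal{E}(G)$ and $\mathcal{E}^{\mathcal{Q}}(G)=\mathrm{Diag}(\mathrm{Tr}_{\mathcal{E}}(G))+\mathcal{E}(G)$. *)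

theory Defs
  imports
    "Jordan_Normal_Form.Char_Poly"
    "Graph_Theory.Digraph_Component"
begin

text \<open>
  A finite simple undirected graph is a digraph satisfying the locale \<open>graph\<close>: every edge
  \<open>{u, v}\<close> is represented by exactly the two arcs from \<open>u\<close> to \<open>v\<close> and from \<open>v\<close> to \<open>u\<close>. Hence
  \<open>out_degree\<close> is the degree, and \<open>apath\<close> gives the paths in the usual sense.
  The matrices below depend on an enumeration \<open>vs\<close> of the vertices
  (\<open>distinct vs\<close>, \<open>set vs = verts G\<close>), with rows and columns indexed from 0.
\<close>

definition gdist :: "('a, 'b) pre_digraph \<Rightarrow> 'a \<Rightarrow> 'a \<Rightarrow> nat" where
  "gdist G u v = (LEAST k. \<exists>p. pre_digraph.apath G u p v \<and> length p = k)"

definition ecc :: "('a, 'b) pre_digraph \<Rightarrow> 'a \<Rightarrow> nat" where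
  "ecc G u = Max (gdist G u ` verts G)"

definition diam :: "('a, 'b) pre_digraph \<Rightarrow> nat" where
  "diam G = Max (ecc G ` verts G)"

definition universal_vertex :: "('a, 'b) pre_digraph \<Rightarrow> 'a \<Rightarrow> bool" where
  "universal_vertex G v \<longleftrightarrow> v \<in> verts G \<and> out_degree G v = card (verts G) - 1"

definition regular_graph :: "('a, 'b) pre_digraph \<Rightarrow> nat \<Rightarrow> bool" where
  "regular_graph G r \<longleftrightarrow> (\<forall>v \<in> verts G. out_degree G v = r)"

definition adj_mat :: "('a, 'b) pre_digraph \<Rightarrow> 'a list \<Rightarrow> real mat" where
  "adj_mat G vs = mat (length vs) (length vs)
     (\<lambda>(i, j). if vs ! i \<rightarrow>\<^bsub>G\<^esub> vs ! j then 1 else 0)"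

definition deg_mat :: "('a, 'b) pre_digraph \<Rightarrow> 'a list \<Rightarrow> real mat" where
  "deg_mat G vs = mat_diag (length vs) (\<lambda>i. real (out_degree G (vs ! i)))"

definition lap_mat :: "('a, 'b) pre_digraph \<Rightarrow> 'a list \<Rightarrow> real mat" where
  "lap_mat G vs = deg_mat G vs - adj_mat G vs"

definition signless_lap_mat :: "('a, 'b) pre_digraph \<Rightarrow> 'a list \<Rightarrow> real mat" where
  "signless_lap_mat G vs = deg_mat G vs + adj_mat G vs"

definition ecc_mat :: "('a, 'b) pre_digraph \<Rightarrow> 'a list \<Rightarrow> real mat" where
  "ecc_mat G vs = mat (length vs) (length vs)
     (\<lambda>(i, j). if gdist G (vs ! i) (vs ! j) = min (ecc G (vs ! i)) (ecc G (vs ! j))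
               then real (gdist G (vs ! i) (vs ! j)) else 0)"

definition ecc_tr_mat :: "('a, 'b) pre_digraph \<Rightarrow> 'a list \<Rightarrow> real mat" where
  "ecc_tr_mat G vs = mat_diag (length vs) (\<lambda>i. \<Sum>j<length vs. ecc_mat G vs $$ (i, j))"

definition ecc_lap_mat :: "('a, 'b) pre_digraph \<Rightarrow> 'a list \<Rightarrow> real mat" where
  "ecc_lap_mat G vs = ecc_tr_mat G vs - ecc_mat G vs"

definition ecc_signless_lap_mat :: "('a, 'b) pre_digraph \<Rightarrow> 'a list \<Rightarrow> real mat" where
  "ecc_signless_lap_mat G vs = ecc_tr_mat G vs + ecc_mat G vs"

text \<open>
  The spectrum with multiplicities. All matrices here are real symmetric, so their
  characteristic polynomials split over the reals and no eigenvalue is lost by counting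
  real roots only.
\<close>

definition spectrum_mset :: "real mat \<Rightarrow> real multiset" where
  "spectrum_mset A = proots (char_poly A)"

definition ones_vec :: "nat \<Rightarrow> real vec" where
  "ones_vec n = vec n (\<lambda>_. 1)"

end

theory Submission
  imports Defs
begin

text \<open>
  Without a universal vertex every vertex has eccentricity at least 2, and the diameter bounds it
  by 2. Therefore the eccentricity matrix is \<open>2 (J - I - A)\<close>, where \<open>J\<close> is the all-ones matrix
  and \<open>A\<close> the adjacency matrix. Substituting this gives
  \<open>E\<^sup>L = 2n I - 2 L - 2 J\<close> (\<open>ecc_lap_mat_entry\<close>) and, for an \<open>r\<close>-regular graph,
  \<open>E\<^sup>Q = (2n - 4) I - 2 Q + 2 J\<close> (\<open>ecc_signless_lap_mat_entry\<close>).

  Both claims are thus instances of one statement (\<open>affine_all_ones_perturbation\<close>) on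
  \<open>a I + b M + t J\<close>, where \<open>M\<close> is symmetric and has the all-ones vector as an eigenvector for
  \<open>c\<close>. For a vector \<open>x\<close> with entry sum 0 we have \<open>J x = 0\<close>, so eigenvectors of \<open>M\<close> orthogonal
  to the all-ones vector stay eigenvectors, an eigenvalue \<open>m\<close> becoming \<open>a + b m\<close>, whereas the eigenvalue
  of the all-ones vector becomes \<open>a + b c + t n\<close>. The multiplicities are read off from the
  characteristic polynomials: splitting off the all-ones vector leaves a quotient that does
  not depend on \<open>t\<close> (\<open>char_poly_deflate\<close>).

  An eigenvector of \<open>M\<close> is orthogonal to the all-ones vector as soon as its eigenvalue differs
  from \<open>c\<close>. It remains to see that \<open>c\<close> occurs only once in the spectrum, so that no other
  eigenvalue of the list equals \<open>c\<close>. This is where connectedness enters: the kernel of \<open>L\<close>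
  consists of constant vectors (\<open>lap_mat_kernel_constant\<close>), and for regular graphs the
  eigenspace of \<open>Q\<close> for \<open>2r\<close> is that kernel, because \<open>Q = 2r I - L\<close>. That the algebraic
  multiplicity is 1 as well follows by comparing the spectra of \<open>M\<close> and \<open>M + J\<close>
  (\<open>simple_eigenvalue\<close>).
\<close>

section \<open>Deflating a matrix with constant row sums\<close>

definition row_sums :: "real mat \<Rightarrow> nat \<Rightarrow> real \<Rightarrow> bool" where
  "row_sums M n c \<longleftrightarrow> M \<in> carrier_mat n n \<and> (\<forall>i<n. (\<Sum>j<n. M $$ (i, j)) = c)"

text \<open>
  For \<open>s = 1\<close> this is the change of basis that replaces the first unit vector by the all-ones
  vector; its inverse has \<open>s = - 1\<close>.
\<close>
definition shear :: "real \<Rightarrow> nat \<Rightarrow> real mat" where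
  "shear s n = mat n n (\<lambda>(i, j). if i = j then 1 else if j = 0 then s else 0)"

lemma shear_carrier [simp]: "shear s n \<in> carrier_mat n n"
  by (simp add: shear_def)

lemma mult_mat_index:
  fixes A B :: "real mat"
  assumes "A \<in> carrier_mat n n" "B \<in> carrier_mat n n" "i < n" "j < n"
  shows "(A * B) $$ (i, j) = (\<Sum>k<n. A $$ (i, k) * B $$ (k, j))"
  using assms by (auto simp: scalar_prod_def lessThan_atLeast0 intro!: sum.cong)

lemma shear_mult_index:
  assumes "B \<in> carrier_mat n n" "i < n" "j < n"
  shows "(shear s n * B) $$ (i, j) = B $$ (i, j) + (if i = 0 then 0 else s * B $$ (0, j))"
proof -
  have "(shear s n * B) $$ (i, j)
      = (\<Sum>k<n. (if k = i then B $$ (k, j) else 0)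
              + (if k = 0 then if i = 0 then 0 else s * B $$ (k, j) else 0))"
    unfolding mult_mat_index[OF shear_carrier assms]
    using assms by (intro sum.cong) (auto simp: shear_def)
  also have "\<dots> = B $$ (i, j) + (if i = 0 then 0 else s * B $$ (0, j))"
    using assms by (auto simp: sum.distrib)
  finally show ?thesis .
qed

lemma mult_shear_index:
  assumes "A \<in> carrier_mat n n" "i < n" "j < n"
  shows "(A * shear 1 n) $$ (i, j) = (if j = 0 then (\<Sum>k<n. A $$ (i, k)) else A $$ (i, j))"
proof -
  have "(A * shear 1 n) $$ (i, j)
      = (\<Sum>k<n. if j = 0 then A $$ (i, k) else if k = j then A $$ (i, k) else 0)"
    unfolding mult_mat_index[OF assms(1) shear_carrier assms(2,3)]
    using assms by (intro sum.cong) (auto simp: shear_def)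
  also have "\<dots> = (if j = 0 then (\<Sum>k<n. A $$ (i, k)) else A $$ (i, j))"
    using assms by auto
  finally show ?thesis .
qed

lemma shear_inverse: "shear s n * shear (- s) n = 1\<^sub>m n"
proof (rule eq_matI)
  fix i j assume "i < dim_row (1\<^sub>m n :: real mat)" "j < dim_col (1\<^sub>m n :: real mat)"
  hence ij: "i < n" "j < n" by auto
  show "(shear s n * shear (- s) n) $$ (i, j) = 1\<^sub>m n $$ (i, j)"
    unfolding shear_mult_index[OF shear_carrier ij] using ij by (auto simp: shear_def)
qed (auto simp: shear_def)

text \<open>
  In a basis whose first vector is the all-ones vector, the first column of the matrix is
  \<open>(c, 0, \<dots>, 0)\<close>, because the all-ones vector is an eigenvector for \<open>c\<close>.
  The remaining diagonal block consists of differences of entries within one column.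
\<close>
lemma char_poly_deflate:
  assumes "row_sums M (Suc m) c"
  shows "char_poly M = [:- c, 1:] *
           char_poly (mat m m (\<lambda>(i, j). M $$ (Suc i, Suc j) - M $$ (0, Suc j)))"
    (is "_ = _ * char_poly ?D")
proof -
  let ?n = "Suc m" and ?P = "shear 1 (Suc m)" and ?Q = "shear (- 1) (Suc m)"
  let ?B = "four_block_mat (mat 1 1 (\<lambda>_. c)) (mat 1 m (\<lambda>(i, j). M $$ (0, Suc j))) (0\<^sub>m m 1) ?D"
  have M: "M \<in> carrier_mat ?n ?n" and rs: "\<And>i. i < ?n \<Longrightarrow> (\<Sum>j<?n. M $$ (i, j)) = c"
    using assms by (auto simp: row_sums_def)
  have B: "?B \<in> carrier_mat ?n ?n"
    by (rule carrier_matI) auto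
  have Bi: "?B $$ (i, j) = (if j = 0 then if i = 0 then c else 0
              else if i = 0 then M $$ (0, j) else M $$ (i, j) - M $$ (0, j))"
    if "i < ?n" "j < ?n" for i j
    using that by auto
  have "M * ?P = ?P * ?B"
  proof (rule eq_matI)
    fix i j assume "i < dim_row (?P * ?B)" "j < dim_col (?P * ?B)"
    hence ij: "i < ?n" "j < ?n" using B by (auto simp: shear_def)
    show "(M * ?P) $$ (i, j) = (?P * ?B) $$ (i, j)"
      unfolding mult_shear_index[OF M ij] shear_mult_index[OF B ij]
      using ij rs[OF ij(1)] Bi[OF ij] Bi[of 0 j] by (simp del: sum.lessThan_Suc)
  qed (use M B in \<open>auto simp: shear_def\<close>)
  hence "M * ?P * ?Q = ?P * ?B * ?Q" by simp
  moreover have "M * ?P * ?Q = M * (?P * ?Q)"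
    by (rule assoc_mult_mat[OF M shear_carrier shear_carrier])
  ultimately have MB: "M = ?P * ?B * ?Q"
    using M by (simp add: shear_inverse del: four_block_mat_def)
  have "similar_mat M ?B"
    unfolding similar_mat_def
  proof (intro exI, rule similar_mat_witI[of _ _ ?n, OF _ _ MB M B])
    show "?Q * ?P = 1\<^sub>m ?n" using shear_inverse[of "- 1" ?n] by simp
  qed (auto simp: shear_inverse)
  hence "char_poly M = char_poly ?B" by (rule char_poly_similar)
  also have "\<dots> = char_poly (mat 1 1 (\<lambda>_. c)) * char_poly ?D"
    by (rule char_poly_four_block_zeros_col) auto
  also have "char_poly (mat 1 1 (\<lambda>_. c)) = [:- c, 1:]"
    by (simp add: char_poly_defs det_single)
  finally show ?thesis .
qed

lemma char_poly_nonzero: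
  assumes "(M :: real mat) \<in> carrier_mat n n"
  shows "char_poly M \<noteq> 0"
  using degree_monic_char_poly[OF assms] by auto

text \<open>
  Adding a multiple of the all-ones matrix does not change differences of entries within a
  column. Hence it moves only the eigenvalue that belongs to the all-ones vector.
\<close>
lemma spectrum_add_all_ones:
  assumes M: "row_sums M n c" and n: "n > 0"
    and N: "N \<in> carrier_mat n n" "\<And>i j. i < n \<Longrightarrow> j < n \<Longrightarrow> N $$ (i, j) = M $$ (i, j) + t"
  shows "spectrum_mset N + {# c #} = spectrum_mset M + {# c + t * real n #}"
proof -
  obtain m where m: "n = Suc m" using n by (cases n) auto
  let ?D = "\<lambda>M. mat m m (\<lambda>(i, j). M $$ (Suc i, Suc j) - M $$ (0, Suc j)) :: real mat"
  have rN: "row_sums N (Suc m) (c + t * real n)"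
    using M N by (auto simp: row_sums_def sum.distrib m simp del: sum.lessThan_Suc)
  have D: "?D N = ?D M" using N(2) m by (intro eq_matI) auto
  have cN: "char_poly N = [:- (c + t * real n), 1:] * char_poly (?D M)"
    using char_poly_deflate[OF rN] unfolding D .
  have cM: "char_poly M = [:- c, 1:] * char_poly (?D M)"
    by (rule char_poly_deflate[OF M[unfolded m]])
  have "proots (char_poly N) = {# c + t * real n #} + proots (char_poly (?D M))"
    using char_poly_nonzero[OF N(1)] unfolding cN by (subst proots_mult) auto
  moreover have "proots (char_poly M) = {# c #} + proots (char_poly (?D M))"
    using char_poly_nonzero[of M n] M unfolding cM row_sums_def by (subst proots_mult) auto
  ultimately show ?thesis by (simp add: spectrum_mset_def)
qed

section \<open>Affine functions of a matrix\<close>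

text \<open>
  The substitution turns a linear factor with root \<open>a + b x\<close> into \<open>b\<close> times one with root \<open>x\<close>.
\<close>
lemma order_pcompose_linear:
  fixes p :: "real poly"
  assumes "p \<noteq> 0" "b \<noteq> 0"
  shows "order x (pcompose p [:a, b:]) = order (a + b * x) p"
proof -
  let ?y = "a + b * x"
  let ?k = "order ?y p"
  obtain q where q: "p = [:- ?y, 1:] ^ ?k * q" "\<not> [:- ?y, 1:] dvd q"
    using order_decomp[OF assms(1)] by blast
  have lin: "pcompose [:- ?y, 1:] [:a, b:] = Polynomial.smult b [:- x, 1:]"
    by (simp add: pcompose_pCons)
  have "pcompose p [:a, b:] = pcompose [:- ?y, 1:] [:a, b:] ^ ?k * pcompose q [:a, b:]"
    by (subst q(1)) (simp only: pcompose_hom.hom_mult pcompose_hom.hom_power)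
  hence eq: "pcompose p [:a, b:] = [:- x, 1:] ^ ?k * Polynomial.smult (b ^ ?k) (pcompose q [:a, b:])"
    unfolding lin smult_power by (simp only: mult_smult_left mult_smult_right)
  have "poly q ?y \<noteq> 0" using q(2) by (simp add: poly_eq_0_iff_dvd)
  hence nd: "\<not> [:- x, 1:] dvd Polynomial.smult (b ^ ?k) (pcompose q [:a, b:])"
    using assms(2) by (simp add: poly_eq_0_iff_dvd[symmetric] poly_pcompose mult.commute)
  show ?thesis
  proof (rule order_unique_lemma)
    show "[:- x, 1:] ^ ?k dvd pcompose p [:a, b:]" unfolding eq by (rule dvd_triv_left)
    show "\<not> [:- x, 1:] ^ Suc ?k dvd pcompose p [:a, b:]"
      unfolding eq power_Suc2 using nd by (subst dvd_mult_cancel_left) auto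
  qed
qed

lemma proots_pcompose_linear:
  fixes p :: "real poly"
  assumes "p \<noteq> 0" "b \<noteq> 0"
  shows "proots p = image_mset (\<lambda>x. a + b * x) (proots (pcompose p [:a, b:]))"
proof (rule multiset_eqI)
  fix y
  have y: "y = a + b * ((y - a) / b)" using assms(2) by simp
  have "pcompose p [:a, b:] \<noteq> 0"
    using assms by (simp add: pcompose_eq_0_iff)
  hence "count (proots (pcompose p [:a, b:])) ((y - a) / b) = count (proots p) y"
    using order_pcompose_linear[OF assms, of "(y - a) / b" a] assms(1) y by simp
  moreover have "(\<lambda>x. a + b * x) -` {y} = {(y - a) / b}"
    using assms(2) by (auto simp: field_simps)
  ultimately show "count (proots p) y
      = count (image_mset (\<lambda>x. a + b * x) (proots (pcompose p [:a, b:]))) y"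
    by (cases "(y - a) / b \<in># proots (pcompose p [:a, b:])") (auto simp: count_image_mset not_in_iff)
qed

text \<open>
  Substituting \<open>a + b X\<close> for \<open>X\<close> in \<open>X I - (a I + b M)\<close> leaves \<open>b (X I - M)\<close>.
\<close>
lemma spectrum_affine:
  assumes M: "M \<in> carrier_mat n n" and b: "b \<noteq> 0"
    and N: "N \<in> carrier_mat n n"
      "\<And>i j. i < n \<Longrightarrow> j < n \<Longrightarrow> N $$ (i, j) = (if i = j then a else 0) + b * M $$ (i, j)"
  shows "spectrum_mset N = image_mset (\<lambda>x. a + b * x) (spectrum_mset M)"
proof -
  have "map_mat (\<lambda>p. pcompose p [:a, b:]) (char_poly_matrix N) = [:b:] \<cdot>\<^sub>m char_poly_matrix M"
    using M N by (intro eq_matI) (auto simp: char_poly_matrix_def pcompose_pCons)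
  hence "pcompose (char_poly N) [:a, b:] = det ([:b:] \<cdot>\<^sub>m char_poly_matrix M)"
    unfolding char_poly_def comm_ring_hom.hom_det[OF pcompose_hom.comm_ring_hom_axioms, symmetric] by simp
  also have "\<dots> = Polynomial.smult (b ^ n) (char_poly M)"
    using char_poly_matrix_closed[OF M]
    by (simp add: char_poly_def poly_const_pow)
  finally have "proots (pcompose (char_poly N) [:a, b:]) = proots (char_poly M)"
    using b by simp
  thus ?thesis
    unfolding spectrum_mset_def
    using proots_pcompose_linear[OF char_poly_nonzero[OF N(1)] b, of a] by simp
qed


section \<open>Symmetric matrices with constant row sums\<close>

lemma mult_mat_vec_index:
  fixes M :: "real mat"
  assumes "M \<in> carrier_mat n n" "x \<in> carrier_vec n" "i < n"
  shows "(M *\<^sub>v x) $ i = (\<Sum>j<n. M $$ (i, j) * x $ j)"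
  using assms by (auto simp: scalar_prod_def lessThan_atLeast0 intro!: sum.cong)

lemma eigenvector_iff_sums:
  fixes M :: "real mat"
  assumes "M \<in> carrier_mat n n"
  shows "eigenvector M x e \<longleftrightarrow> x \<in> carrier_vec n \<and> x \<noteq> 0\<^sub>v n
           \<and> (\<forall>i<n. (\<Sum>j<n. M $$ (i, j) * x $ j) = e * x $ i)"
proof (cases "x \<in> carrier_vec n")
  case True
  hence "M *\<^sub>v x = e \<cdot>\<^sub>v x \<longleftrightarrow> (\<forall>i<n. (\<Sum>j<n. M $$ (i, j) * x $ j) = e * x $ i)"
    using assms mult_mat_vec_index[OF assms True] by (auto simp: vec_eq_iff)
  thus ?thesis using assms by (auto simp: eigenvector_def)
qed (use assms in \<open>auto simp: eigenvector_def\<close>)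

lemma ones_vec_eigenvector:
  assumes "row_sums M n c" "n > 0"
  shows "eigenvector M (ones_vec n) c"
proof -
  have M: "M \<in> carrier_mat n n" using assms by (simp add: row_sums_def)
  have "ones_vec n \<noteq> 0\<^sub>v n" using assms(2) by (auto simp: ones_vec_def vec_eq_iff)
  thus ?thesis
    unfolding eigenvector_iff_sums[OF M] using assms by (auto simp: row_sums_def ones_vec_def)
qed

definition symmetric_entries :: "real mat \<Rightarrow> nat \<Rightarrow> bool" where
  "symmetric_entries M n \<longleftrightarrow> (\<forall>i<n. \<forall>j<n. M $$ (i, j) = M $$ (j, i))"

text \<open>
  Pairing with the all-ones vector from the left: by symmetry the column sums of \<open>M\<close> are
  constant as well.
\<close>
lemma sum_mult_vec:
  assumes "row_sums M n c" "symmetric_entries M n"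
  shows "(\<Sum>i<n. \<Sum>j<n. M $$ (i, j) * x $ j) = c * (\<Sum>j<n. x $ j)"
proof -
  have "(\<Sum>i<n. \<Sum>j<n. M $$ (i, j) * x $ j) = (\<Sum>j<n. \<Sum>i<n. M $$ (i, j) * x $ j)"
    by (rule sum.swap)
  also have "\<dots> = (\<Sum>j<n. \<Sum>i<n. M $$ (j, i) * x $ j)"
    using assms(2) by (intro sum.cong) (auto simp: symmetric_entries_def)
  also have "\<dots> = (\<Sum>j<n. c * x $ j)"
    using assms(1) by (auto simp: row_sums_def sum_distrib_right[symmetric])
  finally show ?thesis by (simp add: sum_distrib_left)
qed

text \<open>
  Eigenvectors of a symmetric matrix for different eigenvalues are orthogonal; here one of them
  is the all-ones vector.
\<close>
lemma eigenvector_sum_zero: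
  assumes M: "row_sums M n c" "symmetric_entries M n"
    and x: "eigenvector M x e" and "e \<noteq> c"
  shows "(\<Sum>j<n. x $ j) = 0"
proof -
  have "M \<in> carrier_mat n n" using M by (simp add: row_sums_def)
  hence "(\<Sum>i<n. \<Sum>j<n. M $$ (i, j) * x $ j) = (\<Sum>i<n. e * x $ i)"
    using x by (simp add: eigenvector_iff_sums)
  hence "c * (\<Sum>j<n. x $ j) = e * (\<Sum>j<n. x $ j)"
    unfolding sum_mult_vec[OF M] by (simp add: sum_distrib_left)
  thus ?thesis using \<open>e \<noteq> c\<close> by simp
qed

definition constant_eigenspace :: "real mat \<Rightarrow> nat \<Rightarrow> real \<Rightarrow> bool" where
  "constant_eigenspace M n c \<longleftrightarrow>
     (\<forall>x. eigenvector M x c \<longrightarrow> (\<exists>k. \<forall>i<n. x $ i = k))"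

text \<open>
  Adding the all-ones matrix \<open>J\<close> replaces one copy of \<open>c\<close> in the spectrum by \<open>c + n\<close>.
  A second copy would survive, and give an eigenvector \<open>x\<close> of \<open>M + J\<close> for \<open>c\<close>. Summing the
  eigenvalue equation over all coordinates shows that the entries of \<open>x\<close> add up to 0; so
  \<open>J x = 0\<close>, and \<open>x\<close> is an eigenvector of \<open>M\<close> for \<open>c\<close>. Being constant with sum 0, it vanishes.
  This passes from the geometric to the algebraic multiplicity without diagonalising \<open>M\<close>.
\<close>
lemma simple_eigenvalue:
  assumes M: "row_sums M n c" "symmetric_entries M n" "constant_eigenspace M n c" and n: "n > 0"
  shows "c \<notin># spectrum_mset M - {# c #}"
proof
  assume c: "c \<in># spectrum_mset M - {# c #}"
  have Mc: "M \<in> carrier_mat n n" using M by (simp add: row_sums_def)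
  define N where "N = mat n n (\<lambda>(i, j). M $$ (i, j) + 1)"
  have N: "N \<in> carrier_mat n n" by (simp add: N_def)
  have spec: "spectrum_mset N + {# c #} = spectrum_mset M + {# c + 1 * real n #}"
    by (rule spectrum_add_all_ones[OF M(1) n N]) (simp add: N_def)
  have "count (spectrum_mset N) c + 1 = count (spectrum_mset M) c"
    using arg_cong[OF spec, of "\<lambda>A. count A c"] n by simp
  moreover have "count (spectrum_mset M) c \<ge> 2"
    using c by (simp add: in_diff_count)
  ultimately have "c \<in># spectrum_mset N" by (simp flip: count_greater_zero_iff)
  hence "eigenvalue N c"
    using char_poly_nonzero[OF N] by (simp add: spectrum_mset_def eigenvalue_root_char_poly[OF N])
  then obtain x where "eigenvector N x c" by (auto simp: eigenvalue_def)
  hence x: "x \<in> carrier_vec n" "x \<noteq> 0\<^sub>v n"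
    and Nx: "\<And>i. i < n \<Longrightarrow> (\<Sum>j<n. N $$ (i, j) * x $ j) = c * x $ i"
    by (auto simp: eigenvector_iff_sums[OF N])
  let ?s = "\<Sum>j<n. x $ j"
  have Mx: "(\<Sum>j<n. M $$ (i, j) * x $ j) + ?s = c * x $ i" if "i < n" for i
    using Nx[OF that] that by (simp add: N_def algebra_simps sum.distrib)
  have "(\<Sum>i<n. (\<Sum>j<n. M $$ (i, j) * x $ j) + ?s) = (\<Sum>i<n. c * x $ i)"
    using Mx by simp
  hence s: "?s = 0"
    using n sum_mult_vec[OF M(1,2)] by (simp add: sum.distrib sum_distrib_left[symmetric])
  hence "eigenvector M x c" using Mx x by (simp add: eigenvector_iff_sums[OF Mc])
  then obtain k where k: "\<And>i. i < n \<Longrightarrow> x $ i = k"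
    using M(3) by (auto simp: constant_eigenspace_def)
  hence "k = 0" using s n by simp
  hence "x = 0\<^sub>v n" using k x(1) by (auto simp: vec_eq_iff)
  thus False using x(2) by simp
qed

text \<open>
  On the all-ones vector \<open>a I + b M + t J\<close> acts as \<open>a + b c + t n\<close>, and on vectors with entry
  sum 0 as \<open>a I + b M\<close>. All eigenvectors of \<open>M\<close> other than the constant ones are of the latter
  kind, since \<open>c\<close> is a simple eigenvalue.
\<close>
lemma affine_all_ones_perturbation:
  assumes M: "row_sums M n c" "symmetric_entries M n" "constant_eigenspace M n c" and n: "n > 0"
    and b: "b \<noteq> 0"
    and N: "N \<in> carrier_mat n n"
      "\<And>i j. i < n \<Longrightarrow> j < n \<Longrightarrow> N $$ (i, j) = (if i = j then a else 0) + b * M $$ (i, j) + t"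
    and spec: "spectrum_mset M = {# m i. i \<in># mset_set I #}"
    and k: "finite I" "k \<in> I" "m k = c"
  shows "spectrum_mset N = {# a + b * c + t * real n #} + {# a + b * m i. i \<in># mset_set (I - {k}) #}"
    and "eigenvector N (ones_vec n) (a + b * c + t * real n)"
    and "\<And>i x. \<lbrakk>i \<in> I - {k}; eigenvector M x (m i)\<rbrakk> \<Longrightarrow> eigenvector N x (a + b * m i)"
proof -
  have Mc: "M \<in> carrier_mat n n" and rs: "\<And>i. i < n \<Longrightarrow> (\<Sum>j<n. M $$ (i, j)) = c"
    using M by (auto simp: row_sums_def)
  define A where "A = mat n n (\<lambda>(i, j). (if i = j then a else 0) + b * M $$ (i, j))"
  have A: "A \<in> carrier_mat n n" by (simp add: A_def)
  have rA: "row_sums A n (a + b * c)"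
    using rs by (auto simp: row_sums_def A_def sum.distrib sum_distrib_left[symmetric])
  have NA: "N $$ (i, j) = A $$ (i, j) + t" if "i < n" "j < n" for i j
    using that N(2) by (simp add: A_def)
  have specA: "spectrum_mset A = image_mset (\<lambda>x. a + b * x) (spectrum_mset M)"
    by (rule spectrum_affine[OF Mc b A]) (simp add: A_def)
  have I: "mset_set I = {# k #} + mset_set (I - {k})"
    using k by (simp add: mset_set.remove)
  have "spectrum_mset N + {# a + b * c #} = spectrum_mset A + {# a + b * c + t * real n #}"
    by (rule spectrum_add_all_ones[OF rA n N(1) NA])
  also have "spectrum_mset A = {# a + b * c #} + {# a + b * m i. i \<in># mset_set (I - {k}) #}"
    unfolding specA spec I using k(3) by (simp add: multiset.map_comp o_def)
  finally show "spectrum_mset N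
      = {# a + b * c + t * real n #} + {# a + b * m i. i \<in># mset_set (I - {k}) #}"
    by simp
  have "row_sums N n (a + b * c + t * real n)"
    using rA N(1) NA by (auto simp: row_sums_def sum.distrib)
  thus "eigenvector N (ones_vec n) (a + b * c + t * real n)"
    by (rule ones_vec_eigenvector[OF _ n])
  fix i x assume i: "i \<in> I - {k}" and x: "eigenvector M x (m i)"
  have "spectrum_mset M - {# c #} = {# m i. i \<in># mset_set (I - {k}) #}"
    unfolding spec I using k(3) by simp
  hence "m i \<in># spectrum_mset M - {# c #}" using i k(1) by auto
  hence "m i \<noteq> c" using simple_eigenvalue[OF M n] by auto
  from eigenvector_sum_zero[OF M(1,2) x this] have s: "(\<Sum>j<n. x $ j) = 0" .
  have "(\<Sum>j<n. N $$ (l, j) * x $ j) = (a + b * m i) * x $ l" if l: "l < n" for l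
  proof -
    have "(\<Sum>j<n. N $$ (l, j) * x $ j)
        = (\<Sum>j<n. (if l = j then a * x $ j else 0) + b * (M $$ (l, j) * x $ j) + t * x $ j)"
      using l N(2) by (intro sum.cong) (auto simp: algebra_simps)
    also have "\<dots> = a * x $ l + b * (\<Sum>j<n. M $$ (l, j) * x $ j) + t * (\<Sum>j<n. x $ j)"
      using l by (simp add: sum.distrib sum_distrib_left)
    also have "\<dots> = (a + b * m i) * x $ l"
      using x l s by (simp add: eigenvector_iff_sums[OF Mc] algebra_simps)
    finally show ?thesis .
  qed
  thus "eigenvector N x (a + b * m i)"
    using x by (simp add: eigenvector_iff_sums[OF Mc] eigenvector_iff_sums[OF N(1)])
qed


section \<open>Graphs of diameter two without universal vertex\<close>

lemma (in wf_digraph) gdist_apath: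
  assumes "u \<rightarrow>\<^sup>* v"
  obtains p where "apath u p v" "length p = gdist G u v"
proof -
  obtain p where "apath u p v" using assms reachable_apath by blast
  hence "\<exists>k p. apath u p v \<and> length p = k" by blast
  from LeastI_ex[OF this] show ?thesis using that by (auto simp: gdist_def)
qed

lemma (in wf_digraph) gdist_le: "apath u p v \<Longrightarrow> gdist G u v \<le> length p"
  unfolding gdist_def by (rule Least_le) auto

lemma (in wf_digraph) gdist_self: "u \<in> verts G \<Longrightarrow> gdist G u u = 0"
  using gdist_le[of u "[]" u] by (simp add: apath_Nil_iff)

lemma (in loopfree_digraph) gdist_le_1_iff:
  assumes "u \<rightarrow>\<^sup>* v"
  shows "gdist G u v \<le> 1 \<longleftrightarrow> u = v \<or> u \<rightarrow> v"
proof
  assume le: "gdist G u v \<le> 1"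
  obtain p where p: "apath u p v" "length p = gdist G u v" by (rule gdist_apath[OF assms])
  show "u = v \<or> u \<rightarrow> v"
  proof (cases p)
    case Nil
    thus ?thesis using p by (simp add: apath_Nil_iff)
  next
    case (Cons e es)
    have "length p \<le> 1" using p(2) le by simp
    hence "es = []" using Cons by simp
    thus ?thesis using p Cons by (auto simp: apath_simps arcs_ends_conv)
  qed
next
  assume "u = v \<or> u \<rightarrow> v"
  thus "gdist G u v \<le> 1"
  proof
    assume "u = v"
    thus ?thesis using gdist_self reachable_in_verts(1)[OF assms] by simp
  next
    assume "u \<rightarrow> v"
    then obtain e where e: "e \<in> arcs G" "tail G e = u" "head G e = v" by auto
    hence "apath u [e] v" using no_loops by (auto simp: apath_simps)
    thus ?thesis using gdist_le by fastforce
  qed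
qed

lemma (in digraph) out_degree_card: "out_degree G u = card {v. u \<rightarrow> v}"
proof -
  have "inj_on (head G) (out_arcs G u)"
    using no_multi_arcs by (auto simp: inj_on_def arc_to_ends_def)
  moreover have "head G ` out_arcs G u = {v. u \<rightarrow> v}"
    by (auto simp: arcs_ends_conv)
  ultimately show ?thesis by (metis card_image out_degree_def)
qed

lemma (in graph) connected_reachable:
  assumes "connected G" "u \<in> verts G" "v \<in> verts G"
  shows "u \<rightarrow>\<^sup>* v"
  using symmetric_connected_imp_strongly_connected[OF sym_arcs assms(1)] assms(2,3)
  by auto

text \<open>
  A vertex that is not universal has a vertex other than itself and its neighbours, and hence
  eccentricity at least 2.
\<close>
lemma (in graph) ecc_eq_2:
  assumes conn: "connected G" and diam: "diam G = 2" and nu: "\<nexists>v. universal_vertex G v"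
    and u: "u \<in> verts G"
  shows "ecc G u = 2"
proof (rule antisym)
  show "ecc G u \<le> 2" using u diam Max_ge[of "ecc G ` verts G" "ecc G u"] by (simp add: diam_def)
  have sub: "{v. u \<rightarrow> v} \<subseteq> verts G - {u}"
    using adj_in_verts(2) adj_not_same by blast
  have "{v. u \<rightarrow> v} \<noteq> verts G - {u}"
  proof
    assume "{v. u \<rightarrow> v} = verts G - {u}"
    hence "universal_vertex G u" using u by (simp add: universal_vertex_def out_degree_card)
    thus False using nu by blast
  qed
  then obtain v where v: "v \<in> verts G" "v \<noteq> u" "\<not> u \<rightarrow> v" using sub by blast
  hence "gdist G u v \<ge> 2"
    using gdist_le_1_iff[OF connected_reachable[OF conn u v(1)]] by auto
  moreover have "gdist G u v \<le> ecc G u" using v by (auto simp: ecc_def intro: Max_ge)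
  ultimately show "ecc G u \<ge> 2" by simp
qed

text \<open>
  Since all eccentricities are 2, the eccentricity matrix keeps exactly the distances equal to 2:
  it is twice the adjacency matrix of the complement.
\<close>
lemma (in graph) ecc_mat_entry:
  assumes conn: "connected G" and diam: "diam G = 2" and nu: "\<nexists>v. universal_vertex G v"
    and vs: "distinct vs" "set vs = verts G" and ij: "i < length vs" "j < length vs"
  shows "ecc_mat G vs $$ (i, j) = 2 - (if i = j then 2 else 0) - 2 * adj_mat G vs $$ (i, j)"
proof -
  let ?u = "vs ! i" and ?v = "vs ! j"
  have uv: "?u \<in> verts G" "?v \<in> verts G" using vs ij nth_mem by blast+
  note ecc = ecc_eq_2[OF conn diam nu]
  have "gdist G ?u ?v \<le> ecc G ?u" using uv by (auto simp: ecc_def intro: Max_ge)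
  hence "gdist G ?u ?v \<le> 2" using ecc uv by simp
  hence "gdist G ?u ?v = 2 \<longleftrightarrow> \<not> gdist G ?u ?v \<le> 1" by auto
  hence d: "gdist G ?u ?v = 2 \<longleftrightarrow> i \<noteq> j \<and> \<not> ?u \<rightarrow> ?v"
    using gdist_le_1_iff[OF connected_reachable[OF conn uv]] ij vs(1) by (simp add: nth_eq_iff_index_eq)
  have "\<not> ?u \<rightarrow> ?u" using adj_not_same by blast
  thus ?thesis using d ecc[OF uv(1)] ecc[OF uv(2)] ij by (auto simp: ecc_mat_def adj_mat_def)
qed

lemma (in digraph) adj_mat_row_sum:
  assumes vs: "distinct vs" "set vs = verts G" and i: "i < length vs"
  shows "(\<Sum>j<length vs. adj_mat G vs $$ (i, j)) = real (out_degree G (vs ! i))"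
proof -
  have "(\<Sum>j<length vs. adj_mat G vs $$ (i, j)) = (\<Sum>j<length vs. if vs ! i \<rightarrow> vs ! j then 1 else 0)"
    using i by (simp add: adj_mat_def)
  also have "\<dots> = (\<Sum>v\<in>verts G. if vs ! i \<rightarrow> v then 1 else 0)"
    using vs by (intro sum.reindex_bij_betw bij_betw_nth) auto
  also have "\<dots> = real (card {v. vs ! i \<rightarrow> v})"
  proof -
    have "verts G \<inter> {v. vs ! i \<rightarrow> v} = {v. vs ! i \<rightarrow> v}" using adj_in_verts(2) by blast
    thus ?thesis by (simp add: sum.If_cases)
  qed
  finally show ?thesis by (simp add: out_degree_card)
qed

lemma adj_mat_symmetric: "graph G \<Longrightarrow> symmetric_entries (adj_mat G vs) (length vs)"
  using sym_digraph.graph_symmetric[of G]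
  by (auto simp: symmetric_entries_def adj_mat_def graph_def pseudo_graph_def)

lemma lap_mat_entry:
  assumes "i < length vs" "j < length vs"
  shows "lap_mat G vs $$ (i, j)
    = (if i = j then real (out_degree G (vs ! i)) else 0) - adj_mat G vs $$ (i, j)"
  using assms by (auto simp: lap_mat_def deg_mat_def mat_diag_def adj_mat_def)

lemma signless_lap_mat_entry:
  assumes "i < length vs" "j < length vs"
  shows "signless_lap_mat G vs $$ (i, j)
    = (if i = j then real (out_degree G (vs ! i)) else 0) + adj_mat G vs $$ (i, j)"
  using assms by (auto simp: signless_lap_mat_def deg_mat_def mat_diag_def adj_mat_def)

lemma mat_carriers [simp]:
  "adj_mat G vs \<in> carrier_mat (length vs) (length vs)"
  "lap_mat G vs \<in> carrier_mat (length vs) (length vs)"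
  "signless_lap_mat G vs \<in> carrier_mat (length vs) (length vs)"
  "ecc_lap_mat G vs \<in> carrier_mat (length vs) (length vs)"
  "ecc_signless_lap_mat G vs \<in> carrier_mat (length vs) (length vs)"
  by (auto simp: adj_mat_def lap_mat_def signless_lap_mat_def deg_mat_def mat_diag_def
      ecc_lap_mat_def ecc_signless_lap_mat_def ecc_mat_def)

lemma (in graph) lap_mat_row_sums:
  assumes vs: "distinct vs" "set vs = verts G"
  shows "row_sums (lap_mat G vs) (length vs) 0"
  using adj_mat_row_sum[OF vs] by (auto simp: row_sums_def lap_mat_entry sum_subtractf)

lemma (in graph) signless_lap_mat_row_sums:
  assumes vs: "distinct vs" "set vs = verts G" and r: "regular_graph G r"
  shows "row_sums (signless_lap_mat G vs) (length vs) (2 * real r)"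
proof -
  have "out_degree G (vs ! i) = r" if "i < length vs" for i
    using r vs(2) that nth_mem by (auto simp: regular_graph_def)
  thus ?thesis
    using adj_mat_row_sum[OF vs] by (auto simp: row_sums_def signless_lap_mat_entry sum.distrib)
qed

text \<open>
  A maximum principle. A vector in the kernel of the Laplacian has at each vertex the average of
  its values at the neighbours. A maximal value is therefore shared by all neighbours, and by
  connectedness it spreads over the whole graph.
\<close>
lemma (in graph) lap_mat_kernel_constant:
  assumes conn: "connected G" and vs: "distinct vs" "set vs = verts G"
  shows "constant_eigenspace (lap_mat G vs) (length vs) 0"
  unfolding constant_eigenspace_def
proof (intro allI impI)
  fix x
  let ?n = "length vs" and ?A = "adj_mat G vs"
  assume "eigenvector (lap_mat G vs) x 0"
  hence Lx: "(\<Sum>j<?n. lap_mat G vs $$ (i, j) * x $ j) = 0" if "i < ?n" for i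
    using that by (simp add: eigenvector_iff_sums[OF mat_carriers(2)])
  have harmonic: "(\<Sum>j<?n. ?A $$ (i, j) * (x $ i - x $ j)) = 0" if i: "i < ?n" for i
  proof -
    have "(\<Sum>j<?n. lap_mat G vs $$ (i, j) * x $ j)
        = (\<Sum>j<?n. (if i = j then real (out_degree G (vs ! i)) * x $ j else 0) - ?A $$ (i, j) * x $ j)"
      using i by (intro sum.cong) (auto simp: lap_mat_entry algebra_simps)
    also have "\<dots> = (\<Sum>j<?n. ?A $$ (i, j)) * x $ i - (\<Sum>j<?n. ?A $$ (i, j) * x $ j)"
      using i by (simp add: sum_subtractf adj_mat_row_sum[OF vs i])
    also have "\<dots> = (\<Sum>j<?n. ?A $$ (i, j) * (x $ i - x $ j))"
      by (simp add: sum_distrib_right sum_subtractf right_diff_distrib)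
    finally show ?thesis using Lx[OF i] by simp
  qed
  show "\<exists>k. \<forall>i<?n. x $ i = k"
  proof (cases "?n = 0")
    case False
    define k where "k = Max ((\<lambda>i. x $ i) ` {..<?n})"
    have le: "x $ i \<le> k" if "i < ?n" for i using that by (auto simp: k_def)
    have "k \<in> (\<lambda>i. x $ i) ` {..<?n}" unfolding k_def using False by (intro Max_in) auto
    then obtain i0 where i0: "i0 < ?n" "x $ i0 = k" by auto
    have spread: "\<forall>i<?n. vs ! i = v \<longrightarrow> x $ i = k" if "vs ! i0 \<rightarrow>\<^sup>* v" for v
      using that
    proof (induction rule: reachable_induct)
      case base
      thus ?case using i0 vs(1) nth_eq_iff_index_eq by blast
    next
      case (step u v)
      show ?case
      proof (intro allI impI)
        fix j assume j: "j < ?n" "vs ! j = v"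
        obtain i where i: "i < ?n" "vs ! i = u"
          using adj_in_verts(1)[OF step(2)] vs(2) by (metis in_set_conv_nth)
        hence xi: "x $ i = k" using step(3) by blast
        \<comment> \<open>The value at \<open>i\<close> is maximal, so the vanishing sum has no negative term.\<close>
        have "\<forall>j\<in>{..<?n}. ?A $$ (i, j) * (x $ i - x $ j) = 0"
          using harmonic[OF i(1)] le xi i
          by (subst sum_nonneg_eq_0_iff[symmetric]) (auto simp: adj_mat_def)
        hence "?A $$ (i, j) * (x $ i - x $ j) = 0" using j(1) by simp
        thus "x $ j = k" using step(2) i j xi by (simp add: adj_mat_def)
      qed
    qed
    have "x $ i = k" if "i < ?n" for i
    proof -
      have "vs ! i0 \<rightarrow>\<^sup>* vs ! i"
        using connected_reachable[OF conn] i0(1) that vs(2) nth_mem by blast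
      thus ?thesis using spread that by blast
    qed
    thus ?thesis by blast
  qed simp
qed

text \<open>
  For an \<open>r\<close>-regular graph the two Laplacians satisfy \<open>Q = 2r I - L\<close>.
\<close>
lemma (in graph) signless_lap_mat_eigenspace_constant:
  assumes conn: "connected G" and vs: "distinct vs" "set vs = verts G" and r: "regular_graph G r"
  shows "constant_eigenspace (signless_lap_mat G vs) (length vs) (2 * real r)"
  unfolding constant_eigenspace_def
proof (intro allI impI)
  fix x
  let ?n = "length vs" and ?L = "lap_mat G vs" and ?Q = "signless_lap_mat G vs"
  assume Q: "eigenvector ?Q x (2 * real r)"
  have deg: "out_degree G (vs ! i) = r" if "i < ?n" for i
    using r vs(2) that nth_mem by (auto simp: regular_graph_def)
  have "(\<Sum>j<?n. ?L $$ (i, j) * x $ j) = 0" if i: "i < ?n" for i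
  proof -
    have "(\<Sum>j<?n. ?L $$ (i, j) * x $ j)
        = (\<Sum>j<?n. (if i = j then 2 * real r * x $ j else 0) - ?Q $$ (i, j) * x $ j)"
      using i by (intro sum.cong) (auto simp: lap_mat_entry signless_lap_mat_entry deg algebra_simps)
    also have "\<dots> = 0" using Q i
      by (simp add: sum_subtractf eigenvector_iff_sums[OF mat_carriers(3)])
    finally show ?thesis .
  qed
  hence "eigenvector ?L x 0" using Q
    by (simp add: eigenvector_iff_sums[OF mat_carriers(2)] eigenvector_iff_sums[OF mat_carriers(3)])
  thus "\<exists>k. \<forall>i<?n. x $ i = k"
    using lap_mat_kernel_constant[OF conn vs] by (simp add: constant_eigenspace_def)
qed

lemma (in graph) ecc_tr_mat_entry:
  assumes conn: "connected G" and diam: "diam G = 2" and nu: "\<nexists>v. universal_vertex G v"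
    and vs: "distinct vs" "set vs = verts G" and ij: "i < length vs" "j < length vs"
  shows "ecc_tr_mat G vs $$ (i, j)
    = (if i = j then 2 * (real (length vs) - 1 - real (out_degree G (vs ! i))) else 0)"
proof -
  have "(\<Sum>j<length vs. ecc_mat G vs $$ (i, j))
      = (\<Sum>j<length vs. 2 - (if i = j then 2 else 0) - 2 * adj_mat G vs $$ (i, j))"
    using ij(1) ecc_mat_entry[OF conn diam nu vs] by (intro sum.cong) auto
  also have "\<dots> = 2 * (real (length vs) - 1 - real (out_degree G (vs ! i)))"
    using ij(1) by (simp add: sum_subtractf sum_distrib_left[symmetric] adj_mat_row_sum[OF vs])
  finally show ?thesis using ij by (auto simp: ecc_tr_mat_def mat_diag_def)
qed

lemma (in graph) ecc_lap_mat_entry: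
  assumes conn: "connected G" and diam: "diam G = 2" and nu: "\<nexists>v. universal_vertex G v"
    and vs: "distinct vs" "set vs = verts G" and ij: "i < length vs" "j < length vs"
  shows "ecc_lap_mat G vs $$ (i, j)
    = (if i = j then 2 * real (length vs) else 0) + (- 2) * lap_mat G vs $$ (i, j) + (- 2)"
proof -
  have "ecc_lap_mat G vs $$ (i, j) = ecc_tr_mat G vs $$ (i, j) - ecc_mat G vs $$ (i, j)"
    using ij by (simp add: ecc_lap_mat_def ecc_mat_def)
  thus ?thesis
    using ij by (simp add: ecc_tr_mat_entry[OF assms] ecc_mat_entry[OF assms] lap_mat_entry)
qed

lemma (in graph) ecc_signless_lap_mat_entry:
  assumes conn: "connected G" and diam: "diam G = 2" and nu: "\<nexists>v. universal_vertex G v"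
    and vs: "distinct vs" "set vs = verts G" and ij: "i < length vs" "j < length vs"
    and r: "regular_graph G r"
  shows "ecc_signless_lap_mat G vs $$ (i, j)
    = (if i = j then 2 * real (length vs) - 4 else 0) + (- 2) * signless_lap_mat G vs $$ (i, j) + 2"
proof -
  have "out_degree G (vs ! i) = r"
    using r vs(2) ij nth_mem by (auto simp: regular_graph_def)
  moreover have "ecc_signless_lap_mat G vs $$ (i, j) = ecc_tr_mat G vs $$ (i, j) + ecc_mat G vs $$ (i, j)"
    using ij by (simp add: ecc_signless_lap_mat_def ecc_mat_def)
  ultimately show ?thesis
    using ij by (simp add: ecc_tr_mat_entry[OF assms(1-7)] ecc_mat_entry[OF assms(1-7)]
        signless_lap_mat_entry)
qed

lemma lap_mats_symmetric:
  assumes "graph G"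
  shows "symmetric_entries (lap_mat G vs) (length vs)"
    and "symmetric_entries (signless_lap_mat G vs) (length vs)"
  using adj_mat_symmetric[OF assms, of vs]
  by (auto simp: symmetric_entries_def lap_mat_entry signless_lap_mat_entry)

theorem theorem3p4:
  fixes G :: "('a, 'b) pre_digraph"
    and vs :: "'a list"
    and n :: nat
    and \<mu> q :: "nat \<Rightarrow> real"
  assumes "graph G"
    and "connected G"
    and "distinct vs" and "set vs = verts G"
    and "card (verts G) = n"
    and "diam G = 2"
    and "\<nexists>v. universal_vertex G v"
    and "spectrum_mset (lap_mat G vs) = {# \<mu> i. i \<in># mset_set {1..n} #}"
    and "\<mu> n = 0"
    and "spectrum_mset (signless_lap_mat G vs) = {# q i. i \<in># mset_set {1..n} #}"
  shows
    "(spectrum_mset (ecc_lap_mat G vs)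
        = {# 2 * real n - 2 * \<mu> i. i \<in># mset_set {1..n - 1} #} + {# 0 #}
      \<and> (\<forall>i \<in> {1..n - 1}. \<forall>x. eigenvector (lap_mat G vs) x (\<mu> i)
            \<longrightarrow> eigenvector (ecc_lap_mat G vs) x (2 * real n - 2 * \<mu> i))
      \<and> eigenvector (lap_mat G vs) (ones_vec n) 0
      \<and> eigenvector (ecc_lap_mat G vs) (ones_vec n) 0)
     \<and>
     (\<forall>r. regular_graph G r \<and> q 1 = 2 * real r \<longrightarrow>
        spectrum_mset (ecc_signless_lap_mat G vs)
          = {# 4 * (real n - real r - 1) #}
            + {# 2 * real n - 4 - 2 * q i. i \<in># mset_set {2..n} #}
        \<and> eigenvector (signless_lap_mat G vs) (ones_vec n) (2 * real r)
        \<and> eigenvector (ecc_signless_lap_mat G vs) (ones_vec n) (4 * (real n - real r - 1))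
        \<and> (\<forall>i \<in> {2..n}. \<forall>x. eigenvector (signless_lap_mat G vs) x (q i)
              \<longrightarrow> eigenvector (ecc_signless_lap_mat G vs) x (2 * real n - 4 - 2 * q i)))"
proof -
  interpret graph G by fact
  note vs = \<open>distinct vs\<close> \<open>set vs = verts G\<close>
  note ass = \<open>connected G\<close> \<open>diam G = 2\<close> \<open>\<nexists>v. universal_vertex G v\<close> vs
  have len: "length vs = n" using vs \<open>card (verts G) = n\<close> distinct_card by fastforce
  have "verts G \<noteq> {}" using \<open>connected G\<close> by (simp add: connected_conv)
  hence n: "n > 0" using \<open>card (verts G) = n\<close> by (metis card_gt_0_iff finite_verts)
  have L: "row_sums (lap_mat G vs) n 0" "symmetric_entries (lap_mat G vs) n"
    "constant_eigenspace (lap_mat G vs) n 0"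
    using lap_mat_row_sums[OF vs] lap_mats_symmetric(1)[OF \<open>graph G\<close>, of vs]
      lap_mat_kernel_constant[OF \<open>connected G\<close> vs] unfolding len .
  have In: "finite {1..n}" "n \<in> {1..n}" "{1..n} - {n} = {1..n - 1}" using n by auto
  have EL: "ecc_lap_mat G vs \<in> carrier_mat n n" using mat_carriers[of G vs] len by simp
  note EL_entry = ecc_lap_mat_entry[OF ass, unfolded len]
  have two: "(- 2 :: real) \<noteq> 0" by simp
  have signless:
    "spectrum_mset (ecc_signless_lap_mat G vs)
          = {# 4 * (real n - real r - 1) #}
            + {# 2 * real n - 4 - 2 * q i. i \<in># mset_set {2..n} #}
      \<and> eigenvector (signless_lap_mat G vs) (ones_vec n) (2 * real r)
      \<and> eigenvector (ecc_signless_lap_mat G vs) (ones_vec n) (4 * (real n - real r - 1))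
      \<and> (\<forall>i \<in> {2..n}. \<forall>x. eigenvector (signless_lap_mat G vs) x (q i)
              \<longrightarrow> eigenvector (ecc_signless_lap_mat G vs) x (2 * real n - 4 - 2 * q i))"
    if r: "regular_graph G r" "q 1 = 2 * real r" for r
  proof -
    have Q: "row_sums (signless_lap_mat G vs) n (2 * real r)"
      "symmetric_entries (signless_lap_mat G vs) n"
      "constant_eigenspace (signless_lap_mat G vs) n (2 * real r)"
      using signless_lap_mat_row_sums[OF vs r(1)] lap_mats_symmetric(2)[OF \<open>graph G\<close>, of vs]
        signless_lap_mat_eigenspace_constant[OF \<open>connected G\<close> vs r(1)] unfolding len .
    have I1: "1 \<in> {1..n}" "{1..n} - {1} = {2..n}" using n by auto
    have EQ: "ecc_signless_lap_mat G vs \<in> carrier_mat n n" using mat_carriers[of G vs] len by simp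
    have EQ_entry: "ecc_signless_lap_mat G vs $$ (i, j)
        = (if i = j then 2 * real n - 4 else 0) + (- 2) * signless_lap_mat G vs $$ (i, j) + 2"
      if "i < n" "j < n" for i j
      using ecc_signless_lap_mat_entry[OF ass _ _ r(1)] that unfolding len .
    note pert = affine_all_ones_perturbation[OF Q n two EQ EQ_entry assms(10) In(1) I1(1) r(2),
        unfolded I1(2)]
    have eq: "2 * real n - 4 + - 2 * (2 * real r) + 2 * real n = 4 * (real n - real r - 1)"
      "\<And>i. 2 * real n - 4 + - 2 * q i = 2 * real n - 4 - 2 * q i"
      by simp_all
    show ?thesis
      using pert[unfolded eq] ones_vec_eigenvector[OF Q(1) n] by blast
  qed
  note pert = affine_all_ones_perturbation[OF L n two EL EL_entry assms(8) In(1,2) assms(9),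
      unfolded In(3)]
  have eq: "2 * real n + - 2 * 0 + - 2 * real n = 0"
    "\<And>i. 2 * real n + - 2 * \<mu> i = 2 * real n - 2 * \<mu> i"
    by simp_all
  show ?thesis
    using pert[unfolded eq] ones_vec_eigenvector[OF L(1) n] signless by (simp only: add.commute) blast
qed

end
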